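(* Let $d\geq2$, let $N\ge 2$ be odd, and let $$P_N^{(d)}=\{(t,|t|^2):t\in\mathbb Z_N^{d-1}\}\subseteq\mathbb Z_N^d,\qquad |t|^2=t_1^2+\cdots+t_{d-1}^2\in\mathbb Z_N .$$ For $1\leq r<\infty$, define $$D_{N,d}(r)=\sum_{M\mid N}\varphi(M)M^{(d-1)(1-\frac{r}{2})},$$ where the sum is over positive divisors $M$ of $N$ and $\varphi$ is Euler's totient function. Then $$\mathcal C_r(P_N^{(d)})=D_{N,d}(r)^{-\frac{1}{r}}.$$ In particular, uniform spectral synthesis for the sets $P_N^{(d)}$ along any (unbounded) family of odd moduli $N$ holds at exponent $r$ if and only if $D_{N,d}(r)\to\infty$ along that family.
   Context: $\mathbb Z_N=\mathbb Z/N\mathbb Z$; limits as $N\to\infty$ are taken within the given unbounded set of moduli. For $f:\mathbb Z_N^d\to\mathbb C$ the unitary Fourier transform is $\widehat f(\xi)=N^{-d/2}\sum_{x\in\mathbb Z_N^d}f(x)e^{-2\pi i x\cdot\xi/N}$. All norms use counting measure: $\|f\|_r=(\sum_x|f(x)|^r)^{1/r}$, $\|f\|_\infty=\max_x|f(x)|$. For nonempty $S\subseteq\mathbb Z_N^d$ and $1\le r<\infty$, $$\mathcal C_r(S)=\sup_{f\neq0,\ \operatorname{supp}(f)\subseteq S}\frac{\|\widehat f\|_\infty}{\|\widehat f\|_r}.$$ A family of nonempty sets $\{S_N\}$, $S_N\subseteq\mathbb Z_N^d$, admits uniform spectral synthesis at exponent $r$ if every sequence of functions $f_N:\mathbb Z_N^d\to\mathbb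 C$ supported on $S_N$ satisfies: $\sup_N\|\widehat f_N\|_r<\infty$ implies $\|\widehat f_N\|_\infty\to0$. *)

theory Defs
  imports "HOL-Analysis.Analysis" "HOL-Number_Theory.Totient"
begin

text \<open>
  The group \<open>\<int>\<^sub>N\<^sup>d\<close> is represented by its canonical residue vectors with coordinates indexed by
  \<open>0, \<dots>, d - 1\<close>. Functions on it are total functions on \<^typ>\<open>nat \<Rightarrow> int\<close> whose values outside
  \<open>zmod_vec N d\<close> are never used.
\<close>

definition zmod_vec :: "nat \<Rightarrow> nat \<Rightarrow> (nat \<Rightarrow> int) set" where
  "zmod_vec N d = ({..<d} \<rightarrow>\<^sub>E {0..<int N})"

definition fourier :: "nat \<Rightarrow> nat \<Rightarrow> ((nat \<Rightarrow> int) \<Rightarrow> complex) \<Rightarrow> (nat \<Rightarrow> int) \<Rightarrow> complex" where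
  "fourier N d f \<xi> =
     complex_of_real (real N powr (- real d / 2)) *
     (\<Sum>x\<in>zmod_vec N d.
        f x * exp (- 2 * complex_of_real pi * \<i> * of_int (\<Sum>j<d. x j * \<xi> j) / of_nat N))"

definition norm_r :: "nat \<Rightarrow> nat \<Rightarrow> real \<Rightarrow> ((nat \<Rightarrow> int) \<Rightarrow> complex) \<Rightarrow> real" where
  "norm_r N d r f = (\<Sum>x\<in>zmod_vec N d. norm (f x) powr r) powr (1 / r)"

definition norm_max :: "nat \<Rightarrow> nat \<Rightarrow> ((nat \<Rightarrow> int) \<Rightarrow> complex) \<Rightarrow> real" where
  "norm_max N d f = Max ((\<lambda>x. norm (f x)) ` zmod_vec N d)"

definition supp :: "nat \<Rightarrow> nat \<Rightarrow> ((nat \<Rightarrow> int) \<Rightarrow> complex) \<Rightarrow> (nat \<Rightarrow> int) set" where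
  "supp N d f = {x \<in> zmod_vec N d. f x \<noteq> 0}"

text \<open>
  The supremum is taken in \<^typ>\<open>real\<close>: for \<open>N > 0\<close> every quotient is at most 1, and for nonempty
  \<open>S \<subseteq> zmod_vec N d\<close> there is at least one. The condition \<open>supp N d f \<noteq> {}\<close> is \<open>f \<noteq> 0\<close> on
  \<open>\<int>\<^sub>N\<^sup>d\<close>.
\<close>

definition synthesis_const :: "nat \<Rightarrow> nat \<Rightarrow> real \<Rightarrow> (nat \<Rightarrow> int) set \<Rightarrow> real" where
  "synthesis_const N d r S =
     (SUP f\<in>{f. supp N d f \<noteq> {} \<and> supp N d f \<subseteq> S}.
        norm_max N d (fourier N d f) / norm_r N d r (fourier N d f))"

text \<open>The limit \<open>N \<rightarrow> \<infinity>\<close> within a set of moduli.\<close>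

definition moduli_at_top :: "nat set \<Rightarrow> nat filter" where
  "moduli_at_top \<N> = inf at_top (principal \<N>)"

definition uniform_spectral_synthesis ::
    "nat set \<Rightarrow> nat \<Rightarrow> (nat \<Rightarrow> (nat \<Rightarrow> int) set) \<Rightarrow> real \<Rightarrow> bool" where
  "uniform_spectral_synthesis \<N> d S r \<longleftrightarrow>
     (\<forall>f :: nat \<Rightarrow> (nat \<Rightarrow> int) \<Rightarrow> complex.
        (\<forall>N\<in>\<N>. supp N d (f N) \<subseteq> S N) \<longrightarrow>
        bdd_above ((\<lambda>N. norm_r N d r (fourier N d (f N))) ` \<N>) \<longrightarrow>
        ((\<lambda>N. norm_max N d (fourier N d (f N))) \<longlongrightarrow> 0) (moduli_at_top \<N>))"

text \<open>
  The update at index \<open>d - 1\<close> appends the last coordinate \<open>|t|\<^sup>2\<close> to \<open>t \<in> \<int>\<^sub>N\<^sup>d\<^sup>-\<^sup>1\<close>.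
\<close>

definition paraboloid :: "nat \<Rightarrow> nat \<Rightarrow> (nat \<Rightarrow> int) set" where
  "paraboloid N d =
     {t(d - 1 := (\<Sum>j<d - 1. (t j)\<^sup>2) mod int N) | t. t \<in> zmod_vec N (d - 1)}"

lemma paraboloid_subset:
  assumes "d \<ge> 1" "N \<ge> 1"
  shows "paraboloid N d \<subseteq> zmod_vec N d"
proof
  fix x assume "x \<in> paraboloid N d"
  then obtain t where t: "t \<in> zmod_vec N (d - 1)"
    and x: "x = t(d - 1 := (\<Sum>j<d - 1. (t j)\<^sup>2) mod int N)"
    by (auto simp: paraboloid_def)
  have "(\<Sum>j<d - 1. (t j)\<^sup>2) mod int N \<in> {0..<int N}"
    using assms by simp
  with t have "x \<in> insert (d - 1) {..<d - 1} \<rightarrow>\<^sub>E {0..<int N}"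
    unfolding x zmod_vec_def by (intro PiE_fun_upd)
  moreover have "insert (d - 1) {..<d - 1} = {..<d}"
    using assms by auto
  ultimately show "x \<in> zmod_vec N d"
    by (simp add: zmod_vec_def)
qed

lemma paraboloid_nonempty:
  assumes "N \<ge> 1"
  shows "paraboloid N d \<noteq> {}"
proof -
  have "zmod_vec N (d - 1) \<noteq> {}"
    using assms by (simp add: zmod_vec_def PiE_eq_empty_iff)
  then show ?thesis by (auto simp: paraboloid_def)
qed

definition divisor_sum :: "nat \<Rightarrow> nat \<Rightarrow> real \<Rightarrow> real" where
  "divisor_sum N d r =
     (\<Sum>M | M dvd N. real (totient M) * real M powr ((real d - 1) * (1 - r / 2)))"

end

theory Submission
  imports Defs "HOL-Real_Asymp.Real_Asymp"
begin

text \<open>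
  Write \<open>n = d - 1\<close> and let \<open>F\<close> be the transform of a function carried by the paraboloid. On the
  slice with last frequency \<open>\<tau>\<close>, \<open>F\<close> is the transform on \<open>\<int>\<^sub>N\<^sup>n\<close> of the density times the chirp
  \<open>e(- \<tau>|t|\<^sup>2/N)\<close>, so Parseval expresses a value \<open>F(\<xi>\<^sub>0, \<tau>\<^sub>0)\<close> through the values on any other
  slice \<open>\<tau>\<close>, weighted by a product of quadratic Gauss sums. If \<open>\<tau> - \<tau>\<^sub>0\<close> has additive order \<open>M\<close>,
  these weights have constant modulus and are supported on \<open>M\<^sup>n\<close> points; the power mean inequality
  then bounds the \<open>r\<close>-th power sum of the slice below by
  \<open>|F(\<xi>\<^sub>0, \<tau>\<^sub>0)|\<^sup>r M\<^bsup>n(1 - r/2)\<^esup>\<close>. There are \<open>\<phi>(M)\<close> slices of order \<open>M\<close>, so summing over \<open>\<tau>\<close> gives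
  the divisor sum. The indicator function of the paraboloid gives equality on each slice.
\<close>

section \<open>Additive characters modulo \<open>N\<close> and their orthogonality\<close>

definition add_char :: "nat \<Rightarrow> int \<Rightarrow> complex" where
  "add_char N k = cis (2 * pi * (of_int k / of_nat N))"

lemma add_char_0 [simp]: "add_char N 0 = 1"
  by (simp add: add_char_def)

lemma add_char_add: "add_char N (a + b) = add_char N a * add_char N b"
  by (simp add: add_char_def cis_mult ring_distribs add_divide_distrib)

lemma cnj_add_char: "cnj (add_char N a) = add_char N (- a)"
  by (simp add: add_char_def cis_cnj)

lemma add_char_sum: "add_char N (\<Sum>i\<in>A. f i) = (\<Prod>i\<in>A. add_char N (f i))"
  by (induction A rule: infinite_finite_induct) (auto simp: add_char_add)

lemma add_char_eq_1_iff:
  assumes "N > 0"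
  shows "add_char N k = 1 \<longleftrightarrow> int N dvd k"
proof
  assume "add_char N k = 1"
  then obtain n :: int where "2 * pi * (of_int k / of_nat N) = of_int n * (2 * pi)"
    unfolding add_char_def exp_eq_1 by (auto simp: cis_conv_exp exp_eq_1)
  then have "(of_int k :: real) = of_int (n * int N)"
    using assms by (simp add: field_simps)
  then show "int N dvd k"
    unfolding of_int_eq_iff by simp
next
  assume "int N dvd k"
  then obtain n where "k = int N * n" ..
  then show "add_char N k = 1"
    using assms by (simp add: add_char_def)
qed

lemma add_char_mod [simp]: "add_char N (k mod int N) = add_char N k"
proof (cases "N = 0")
  case False
  have "add_char N k = add_char N (int N * (k div int N)) * add_char N (k mod int N)"
    by (simp flip: add_char_add)
  also have "add_char N (int N * (k div int N)) = 1"
    using False by (simp add: add_char_eq_1_iff)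
  finally show ?thesis by simp
qed simp

lemma add_char_cong: "[k = l] (mod int N) \<Longrightarrow> add_char N k = add_char N l"
  unfolding cong_def by (metis add_char_mod)

lemma add_char_mult_cancel:
  assumes "M > 0"
  shows "add_char (M * q) (int M * k) = add_char q k"
  using assms by (simp add: add_char_def)

text \<open>Translation modulo \<open>N\<close> permutes the canonical residues, and the assumption
  makes \<open>p\<close> periodic with period \<open>N\<close>.\<close>

lemma sum_residues_shift:
  fixes p :: "int \<Rightarrow> 'a :: comm_monoid_add"
  assumes "\<And>x. p (x mod int N) = p x"
  shows "(\<Sum>x\<in>{0..<int N}. p (x + c)) = (\<Sum>x\<in>{0..<int N}. p x)"
proof -
  have "(\<Sum>x\<in>{0..<int N}. p ((x + c) mod int N)) = (\<Sum>x\<in>{0..<int N}. p x)"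
  proof (rule sum.reindex_bij_witness[of _ "\<lambda>x. (x - c) mod int N" "\<lambda>x. (x + c) mod int N"])
    fix a assume "a \<in> {0..<int N}"
    then show "((a + c) mod int N - c) mod int N = a" "((a - c) mod int N + c) mod int N = a"
      by (simp_all add: mod_simps)
  qed auto
  then show ?thesis by (simp add: assms)
qed

text \<open>Replacing \<open>x\<close> by \<open>x + 1\<close> multiplies the sum by
  \<open>add_char N k\<close>, so the sum vanishes unless that factor is 1.\<close>

lemma sum_add_char:
  assumes "N > 0"
  shows "(\<Sum>x\<in>{0..<int N}. add_char N (k * x)) = (if int N dvd k then of_nat N else 0)"
proof (cases "int N dvd k")
  case True
  then have "add_char N (k * x) = 1" for x
    using assms by (simp add: add_char_eq_1_iff)
  then show ?thesis using True by simp
next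
  case False
  let ?s = "\<Sum>x\<in>{0..<int N}. add_char N (k * x)"
  have "?s = (\<Sum>x\<in>{0..<int N}. add_char N (k * (x + 1)))"
    by (rule sum_residues_shift[symmetric]) (auto intro: add_char_cong simp: cong_def mod_simps)
  also have "\<dots> = add_char N k * ?s"
    by (simp add: ring_distribs add_char_add sum_distrib_left mult.commute)
  finally have "(add_char N k - 1) * ?s = 0"
    by (simp add: algebra_simps)
  moreover have "add_char N k \<noteq> 1"
    using False assms by (simp add: add_char_eq_1_iff)
  ultimately show ?thesis using False by simp
qed

section \<open>Moduli of quadratic Gauss sums\<close>

definition gauss_sum :: "nat \<Rightarrow> int \<Rightarrow> int \<Rightarrow> complex" where
  "gauss_sum N a b = (\<Sum>x\<in>{0..<int N}. add_char N (a * x\<^sup>2 + b * x))"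

lemma gauss_sum_0:
  "N > 0 \<Longrightarrow> gauss_sum N 0 b = (if int N dvd b then of_nat N else 0)"
  by (simp add: gauss_sum_def sum_add_char)

text \<open>Weyl differencing: in the expanded square the substitution \<open>y = h + x\<close>
  leaves a phase linear in \<open>x\<close>, so orthogonality keeps only the differences
  \<open>h\<close> divisible by \<open>M = N / q\<close>. There the quadratic part of the phase
  vanishes modulo \<open>N\<close>, and a linear character sum over \<open>q\<close> residues
  remains.\<close>

lemma norm_gauss_sum_sq:
  assumes "odd N" and q: "int q = gcd a (int N)"
  shows "(norm (gauss_sum N a b))\<^sup>2 = (if int q dvd b then real N * real q else 0)"
proof -
  have "N > 0" using \<open>odd N\<close> by (rule odd_pos)
  have "int q dvd int N" by (simp add: q)
  then have "q dvd N" by simp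
  then obtain M where M: "N = M * q" by (metis dvd_def mult.commute)
  have "M > 0" "q > 0" using \<open>N > 0\<close> M by auto
  define p where "p x = a * x\<^sup>2 + b * x" for x
  \<comment> \<open>After division by \<open>q\<close> the coefficient \<open>a\<close> becomes a
    unit modulo \<open>M\<close>; the factor 2 is harmless because \<open>N\<close> is odd.\<close>
  have dvd: "int N dvd 2 * a * h \<longleftrightarrow> int M dvd h"
    and dvd': "int N dvd a * h \<longleftrightarrow> int M dvd h" for h
  proof -
    obtain a' where a': "a = a' * int q" by (metis dvd_def gcd_dvd1 mult.commute q)
    have "gcd a (int N) = gcd a' (int M) * int q"
      by (simp add: a' M gcd_mult_right mult.commute[of _ "int q"] gcd_mult_left)
    then have "coprime a' (int M)"
      using q \<open>q > 0\<close> \<open>N > 0\<close> by (auto simp: coprime_iff_gcd_eq_1)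
    then show *: "int N dvd a * h \<longleftrightarrow> int M dvd h"
      using \<open>q > 0\<close>
      by (simp add: a' M mult.commute mult.left_commute coprime_commute coprime_dvd_mult_right_iff)
    have "coprime (int N) 2" using \<open>odd N\<close> by simp
    then show "int N dvd 2 * a * h \<longleftrightarrow> int M dvd h"
      by (simp add: coprime_dvd_mult_right_iff * mult.assoc)
  qed
  have "complex_of_real ((norm (gauss_sum N a b))\<^sup>2) = gauss_sum N a b * cnj (gauss_sum N a b)"
    by (rule complex_norm_square)
  also have "\<dots> = (\<Sum>x\<in>{0..<int N}. \<Sum>y\<in>{0..<int N}. add_char N (p y - p x))"
    unfolding gauss_sum_def p_def[symmetric]
    by (subst mult.commute)
      (simp add: sum_product cnj_add_char flip: add_char_add)
  also have "\<dots> = (\<Sum>x\<in>{0..<int N}. \<Sum>h\<in>{0..<int N}. add_char N (p (h + x) - p x))"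
    by (rule sum.cong[OF refl], rule sum_residues_shift[symmetric], rule add_char_cong,
        unfold p_def, intro cong_diff cong_add cong_mult cong_pow cong_refl)
      (simp_all add: cong_def)
  also have "\<dots> = (\<Sum>h\<in>{0..<int N}. \<Sum>x\<in>{0..<int N}. add_char N (p h) * add_char N (2 * a * h * x))"
    by (subst sum.swap, intro sum.cong refl, simp flip: add_char_add)
      (simp add: p_def algebra_simps power2_eq_square)
  also have "\<dots> = (\<Sum>h\<in>{0..<int N}. if int M dvd h then add_char N (p h) * of_nat N else 0)"
    using \<open>N > 0\<close> by (auto simp: sum_add_char dvd simp flip: sum_distrib_left intro!: sum.cong)
  also have "\<dots> = (\<Sum>h\<in>{h\<in>{0..<int N}. int M dvd h}. add_char N (p h) * of_nat N)"
    by (rule sum.inter_filter[symmetric]) simp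
  also have "\<dots> = (\<Sum>h\<in>{h\<in>{0..<int N}. int M dvd h}. add_char N (b * h) * of_nat N)"
  proof (intro sum.cong refl arg_cong2[where f = "(*)"] add_char_cong)
    fix h assume "h \<in> {h\<in>{0..<int N}. int M dvd h}"
    then have "int N dvd a * h * h" using dvd'[of h] by simp
    then show "[p h = b * h] (mod int N)"
      by (simp add: p_def power2_eq_square cong_iff_dvd_diff mult.assoc)
  qed
  \<comment> \<open>The multiples of \<open>M\<close> below \<open>N\<close> are
    \<open>M * k\<close> with \<open>k < q\<close>, which lowers the modulus of the character from
    \<open>N\<close> to \<open>q\<close>.\<close>
  also have "\<dots> = (\<Sum>k\<in>{0..<int q}. add_char N (b * (int M * k)) * of_nat N)"
    using \<open>M > 0\<close>
    by (intro sum.reindex_bij_witness[of _ "\<lambda>k. int M * k" "\<lambda>h. h div int M"])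
      (auto simp: M elim!: dvdE simp: zero_le_mult_iff)
  also have "\<dots> = (\<Sum>k\<in>{0..<int q}. add_char q (b * k) * of_nat N)"
    using \<open>M > 0\<close> by (simp add: M mult.left_commute[of b] add_char_mult_cancel)
  also have "\<dots> = (if int q dvd b then of_nat q else 0) * of_nat N"
    using \<open>q > 0\<close> by (simp add: sum_add_char flip: sum_distrib_right)
  also have "\<dots> = complex_of_real (if int q dvd b then real N * real q else 0)"
    by simp
  finally show ?thesis by (simp only: of_real_eq_iff)
qed

lemma norm_gauss_sum:
  assumes "odd N" and "int q = gcd a (int N)"
  shows "norm (gauss_sum N a b) = (if int q dvd b then sqrt (real N * real q) else 0)"
  using norm_gauss_sum_sq[OF assms, of b]
  by (auto split: if_splits simp flip: real_sqrt_unique)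

section \<open>Exponential sums and counting on residue vectors\<close>

lemma finite_zmod_vec [simp]: "finite (zmod_vec N n)"
  by (auto simp: zmod_vec_def intro: finite_PiE)

lemma sum_prod_zmod_vec:
  fixes h :: "nat \<Rightarrow> int \<Rightarrow> 'a :: comm_semiring_1"
  shows "(\<Sum>t\<in>zmod_vec N n. \<Prod>j<n. h j (t j)) = (\<Prod>j<n. \<Sum>x\<in>{0..<int N}. h j x)"
  unfolding zmod_vec_def by (rule prod_sum_PiE[symmetric]) auto

text \<open>The phase is a sum over coordinates, so the exponential sum factors into one-dimensional
  Gauss sums.\<close>

lemma sum_add_char_quadratic:
  "(\<Sum>t\<in>zmod_vec N n. add_char N (a * (\<Sum>j<n. (t j)\<^sup>2) + (\<Sum>j<n. c j * t j))) =
    (\<Prod>j<n. gauss_sum N a (c j))"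
  unfolding gauss_sum_def sum_prod_zmod_vec[symmetric]
  by (simp add: add_char_sum sum_distrib_left flip: sum.distrib)

lemma norm_sum_add_char_quadratic:
  assumes "odd N" and "int q = gcd a (int N)"
  shows "norm (\<Sum>t\<in>zmod_vec N n. add_char N (a * (\<Sum>j<n. (t j)\<^sup>2) + (\<Sum>j<n. c j * t j))) =
    (if \<forall>j<n. int q dvd c j then sqrt (real N * real q) ^ n else 0)"
  unfolding sum_add_char_quadratic prod_norm[symmetric] norm_gauss_sum[OF assms]
  by (auto intro: prod_zero)

text \<open>This is the quadratic sum with \<open>a = 0\<close>: a product of one-dimensional sums,
  one of which vanishes as soon as \<open>s\<close> and \<open>t\<close> differ, because canonical
  residues congruent modulo \<open>N\<close> are equal.\<close>

lemma sum_add_char_linear: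
  assumes "N > 0" and "t \<in> zmod_vec N n" "s \<in> zmod_vec N n"
  shows "(\<Sum>\<xi>\<in>zmod_vec N n. add_char N (\<Sum>j<n. (s j - t j) * \<xi> j)) =
    (if s = t then of_nat N ^ n else 0)"
proof -
  have eq: "int N dvd s j - t j \<longleftrightarrow> s j = t j" if "j < n" for j
  proof
    assume "int N dvd s j - t j"
    then have "s j mod int N = t j mod int N" by (simp add: mod_eq_dvd_iff)
    then show "s j = t j"
      using assms that by (auto simp: zmod_vec_def PiE_def Pi_def)
  qed simp
  have "s = t \<longleftrightarrow> (\<forall>j<n. s j = t j)"
    using assms by (auto simp: zmod_vec_def intro: PiE_ext)
  moreover have "(\<Sum>\<xi>\<in>zmod_vec N n. add_char N (\<Sum>j<n. (s j - t j) * \<xi> j)) =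
      (\<Prod>j<n. gauss_sum N 0 (s j - t j))"
    by (simp flip: sum_add_char_quadratic)
  ultimately show ?thesis
    using \<open>N > 0\<close> by (auto simp: gauss_sum_0 eq intro: prod_zero)
qed

text \<open>The set is a box: each coordinate independently runs through the \<open>M\<close>
  residues in the class of \<open>c j\<close> modulo \<open>q\<close>.\<close>

lemma card_zmod_vec_cong:
  assumes "N = M * q" "N > 0"
  shows "card {\<xi>\<in>zmod_vec N n. \<forall>j<n. int q dvd \<xi> j - c j} = M ^ n"
proof -
  have "{\<xi>\<in>zmod_vec N n. \<forall>j<n. int q dvd \<xi> j - c j} =
      (\<Pi>\<^sub>E j\<in>{..<n}. {x\<in>{0..<int N}. int q dvd x - c j})"
    by (auto simp: zmod_vec_def PiE_def Pi_def)
  moreover have "card {x\<in>{0..<int N}. int q dvd x - c j} = M" for j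
  proof -
    have "q > 0" using assms by auto
    have "bij_betw (\<lambda>k. int q * k + c j mod int q) {0..<int M} {x\<in>{0..<int N}. int q dvd x - c j}"
    proof (rule bij_betw_byWitness[where f' = "\<lambda>x. x div int q"], safe)
      fix k assume k: "k \<in> {0..<int M}"
      show "(int q * k + c j mod int q) div int q = k"
        using \<open>q > 0\<close> by simp
      have "int q * k + c j mod int q < int q * k + int q"
        using \<open>q > 0\<close> by simp
      also have "\<dots> = int q * (k + 1)" by (simp add: algebra_simps)
      also have "\<dots> \<le> int q * int M"
        using k by (intro mult_left_mono) auto
      finally show "int q * k + c j mod int q \<in> {0..<int N}"
        using k \<open>q > 0\<close> by (simp add: assms mult.commute)
      show "int q dvd int q * k + c j mod int q - c j"
        by (simp add: mod_eq_dvd_iff[symmetric])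
    next
      fix x assume x: "x \<in> {0..<int N}" and "int q dvd x - c j"
      then have "x mod int q = c j mod int q" by (simp add: mod_eq_dvd_iff)
      then show "int q * (x div int q) + c j mod int q = x"
        by (metis mult_div_mod_eq)
      have "x div int q * int q \<le> x"
        using \<open>q > 0\<close> by (simp add: minus_mod_eq_div_mult[symmetric])
      also have "x < int M * int q" using x by (simp add: assms)
      finally show "x div int q \<in> {0..<int M}"
        using x \<open>q > 0\<close> by (simp add: pos_imp_zdiv_nonneg_iff)
    qed
    then show ?thesis by (simp add: bij_betw_same_card[symmetric])
  qed
  ultimately show ?thesis by (simp add: card_PiE)
qed

text \<open>The power mean inequality, from convexity of
  \<open>\<lambda>x. x powr r\<close>.\<close>

lemma powr_sum_le:
  fixes y :: "'a \<Rightarrow> real"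
  assumes "finite B" "1 \<le> r" and nonneg: "\<And>x. x \<in> B \<Longrightarrow> 0 \<le> y x"
  shows "(\<Sum>x\<in>B. y x) powr r \<le> real (card B) powr (r - 1) * (\<Sum>x\<in>B. y x powr r)"
proof -
  \<comment> \<open>Convexity is applied on the positive reals, so the zero terms are removed first;
    passing from \<open>card C\<close> back to \<open>card B\<close> only enlarges the bound because
    \<open>r - 1 \<ge> 0\<close>.\<close>
  define C where "C = {x\<in>B. y x \<noteq> 0}"
  have C: "finite C" "C \<subseteq> B" using \<open>finite B\<close> by (auto simp: C_def)
  have y: "(\<Sum>x\<in>B. y x) = (\<Sum>x\<in>C. y x)" "(\<Sum>x\<in>B. y x powr r) = (\<Sum>x\<in>C. y x powr r)"
    using \<open>finite B\<close> by (auto simp: C_def intro!: sum.mono_neutral_right)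
  show ?thesis
  proof (cases "C = {}")
    case True
    then show ?thesis by (simp add: y)
  next
    case False
    then have c: "card C > 0" using C by (simp add: card_gt_0_iff)
    have "(\<Sum>x\<in>C. (1 / card C) *\<^sub>R y x) powr r \<le> (\<Sum>x\<in>C. (1 / card C) * y x powr r)"
      using C False c nonneg \<open>1 \<le> r\<close>
      by (intro convex_on_sum[OF _ _ powr_convex]) (auto simp: C_def order_less_le)
    then have "((\<Sum>x\<in>C. y x) / card C) powr r \<le> (\<Sum>x\<in>C. y x powr r) / card C"
      by (simp flip: sum_divide_distrib)
    moreover have "(\<Sum>x\<in>C. y x) \<ge> 0" using C nonneg by (auto intro: sum_nonneg)
    ultimately have "(\<Sum>x\<in>C. y x) powr r \<le> real (card C) powr (r - 1) * (\<Sum>x\<in>C. y x powr r)"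
      using c by (simp add: powr_divide powr_diff field_simps)
    also have "\<dots> \<le> real (card B) powr (r - 1) * (\<Sum>x\<in>C. y x powr r)"
      using C \<open>1 \<le> r\<close> \<open>finite B\<close>
      by (intro mult_right_mono powr_mono2 sum_nonneg) (auto intro: card_mono)
    finally show ?thesis by (simp add: y)
  qed
qed

section \<open>Slices of the transform at a fixed last frequency\<close>

text \<open>The transform at \<open>(\<xi>, \<tau>)\<close> of the density \<open>g\<close> on the
  paraboloid, without the unitary factor; \<open>t\<close> is the parameter of the point
  \<open>(t, |t|^2)\<close>.\<close>

definition slice_sum ::
    "nat \<Rightarrow> nat \<Rightarrow> ((nat \<Rightarrow> int) \<Rightarrow> complex) \<Rightarrow> int \<Rightarrow> (nat \<Rightarrow> int) \<Rightarrow> complex" where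
  "slice_sum N n g \<tau> \<xi> =
     (\<Sum>t\<in>zmod_vec N n. g t * add_char N (- (\<tau> * (\<Sum>j<n. (t j)\<^sup>2) + (\<Sum>j<n. t j * \<xi> j))))"

text \<open>Parseval in the first \<open>n\<close> frequencies: summation over \<open>\<xi>\<close>
  forces \<open>s = t\<close>, and the chirp with coefficient \<open>\<tau> - \<tau>\<^sub>0\<close>
  then turns the phase of slice \<open>\<tau>\<close> into that of slice
  \<open>\<tau>\<^sub>0\<close>.\<close>

lemma slice_sum_transfer:
  assumes "N > 0"
  shows "(\<Sum>\<xi>\<in>zmod_vec N n. slice_sum N n g \<tau> \<xi> *
      (\<Sum>s\<in>zmod_vec N n.
        add_char N ((\<tau> - \<tau>\<^sub>0) * (\<Sum>j<n. (s j)\<^sup>2) + (\<Sum>j<n. (\<xi> j - \<xi>\<^sub>0 j) * s j)))) =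
    of_nat N ^ n * slice_sum N n g \<tau>\<^sub>0 \<xi>\<^sub>0"
    (is "?lhs = ?rhs")
proof -
  let ?V = "zmod_vec N n"
  \<comment> \<open>\<open>w\<close> gathers everything independent of \<open>\<xi>\<close>, so that
    the sum over \<open>\<xi>\<close> can be carried out first.\<close>
  define w where "w t s = g t * add_char N ((\<tau> - \<tau>\<^sub>0) * (\<Sum>j<n. (s j)\<^sup>2)
      - \<tau> * (\<Sum>j<n. (t j)\<^sup>2) - (\<Sum>j<n. s j * \<xi>\<^sub>0 j))" for t s
  have phase: "(\<tau> - \<tau>\<^sub>0) * S - \<tau> * S - Y = - (\<tau>\<^sub>0 * S + Y)" for S Y :: int
    by (simp add: algebra_simps)
  have "?lhs = (\<Sum>\<xi>\<in>?V. \<Sum>t\<in>?V. \<Sum>s\<in>?V. w t s * add_char N (\<Sum>j<n. (s j - t j) * \<xi> j))"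
    unfolding slice_sum_def sum_product
    by (intro sum.cong refl)
      (simp add: w_def mult.assoc add_char_add[symmetric],
       simp add: algebra_simps sum_subtractf)
  also have "\<dots> = (\<Sum>t\<in>?V. \<Sum>s\<in>?V. w t s * (\<Sum>\<xi>\<in>?V. add_char N (\<Sum>j<n. (s j - t j) * \<xi> j)))"
    unfolding sum_distrib_left
    by (subst sum.swap, rule sum.cong[OF refl], subst sum.swap, rule refl)
  also have "\<dots> = (\<Sum>t\<in>?V. \<Sum>s\<in>?V. if s = t then w t t * of_nat N ^ n else 0)"
    using \<open>N > 0\<close> by (intro sum.cong refl) (auto simp: sum_add_char_linear)
  also have "\<dots> = (\<Sum>t\<in>?V. w t t * of_nat N ^ n)"
    by simp
  also have "\<dots> = (\<Sum>t\<in>?V. of_nat N ^ n *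
      (g t * add_char N (- (\<tau>\<^sub>0 * (\<Sum>j<n. (t j)\<^sup>2) + (\<Sum>j<n. t j * \<xi>\<^sub>0 j)))))"
    by (simp only: w_def phase mult.commute[of _ "of_nat N ^ n"])
  also have "\<dots> = ?rhs"
    by (simp only: slice_sum_def sum_distrib_left)
  finally show ?thesis .
qed

text \<open>The weights in \<open>slice_sum_transfer\<close> have modulus
  \<open>sqrt (N * q) ^ n\<close> on \<open>M ^ n\<close> points, with \<open>M = N div q\<close>,
  and vanish elsewhere. The triangle inequality contributes \<open>M powr (- n / 2)\<close> before
  the \<open>r\<close>-th power is taken, and the power mean inequality contributes
  \<open>(M ^ n) powr (r - 1)\<close> after it; the exponents of \<open>M\<close> add up to
  \<open>- n * (1 - r / 2)\<close>.\<close>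

lemma slice_sum_powr_le:
  assumes "odd N" "1 \<le> r" and q: "int q = gcd (\<tau> - \<tau>\<^sub>0) (int N)"
  shows "norm (slice_sum N n g \<tau>\<^sub>0 \<xi>\<^sub>0) powr r * real (N div q) powr (real n * (1 - r / 2))
    \<le> (\<Sum>\<xi>\<in>zmod_vec N n. norm (slice_sum N n g \<tau> \<xi>) powr r)"
proof -
  have "N > 0" using \<open>odd N\<close> by (rule odd_pos)
  have "int q dvd int N" by (simp add: q)
  then have "q dvd N" by simp
  then obtain M where M: "N = M * q" by (metis dvd_def mult.commute)
  have "M > 0" "q > 0" using \<open>N > 0\<close> M by auto
  define T where "T \<xi> = norm (slice_sum N n g \<tau> \<xi>)" for \<xi>
  define A where "A = norm (slice_sum N n g \<tau>\<^sub>0 \<xi>\<^sub>0)"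
  define B where "B = {\<xi>\<in>zmod_vec N n. \<forall>j<n. int q dvd \<xi> j - \<xi>\<^sub>0 j}"
  have "finite B" "B \<subseteq> zmod_vec N n" by (auto simp: B_def)
  have card: "card B = M ^ n"
    unfolding B_def using M \<open>N > 0\<close> by (rule card_zmod_vec_cong)
  have "real N ^ n * A = norm (of_nat N ^ n * slice_sum N n g \<tau>\<^sub>0 \<xi>\<^sub>0)"
    by (simp add: A_def norm_mult norm_power)
  also have "\<dots> \<le> (\<Sum>\<xi>\<in>zmod_vec N n.
      if \<forall>j<n. int q dvd \<xi> j - \<xi>\<^sub>0 j then sqrt (real N * real q) ^ n * T \<xi> else 0)"
    unfolding slice_sum_transfer[OF \<open>N > 0\<close>, of n g \<tau> \<tau>\<^sub>0 \<xi>\<^sub>0, symmetric]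
    by (rule sum_norm_le)
      (auto simp: norm_mult norm_sum_add_char_quadratic[OF \<open>odd N\<close> q] T_def)
  also have "\<dots> = sqrt (real N * real q) ^ n * (\<Sum>\<xi>\<in>B. T \<xi>)"
    unfolding B_def sum_distrib_left by (rule sum.inter_filter[symmetric]) simp
  finally have "A \<le> (sqrt (real N * real q) / real N) ^ n * (\<Sum>\<xi>\<in>B. T \<xi>)"
    using \<open>N > 0\<close> by (simp add: power_divide field_simps)
  also have "sqrt (real N * real q) / real N = real M powr (- 1 / 2)"
    using \<open>M > 0\<close> \<open>q > 0\<close>
    by (simp add: M real_sqrt_mult powr_minus powr_half_sqrt field_simps)
  also have "\<dots> ^ n = real M powr (- real n / 2)"
    using \<open>M > 0\<close> by (simp add: powr_realpow[symmetric] powr_powr)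
  finally have "A powr r \<le> (real M powr (- real n / 2) * (\<Sum>\<xi>\<in>B. T \<xi>)) powr r"
    using \<open>1 \<le> r\<close> by (intro powr_mono2) (auto simp: A_def)
  also have "\<dots> = real M powr (- real n * r / 2) * (\<Sum>\<xi>\<in>B. T \<xi>) powr r"
    by (simp add: powr_mult powr_powr T_def sum_nonneg)
  also have "\<dots> \<le> real M powr (- real n * r / 2) *
      (real (card B) powr (r - 1) * (\<Sum>\<xi>\<in>B. T \<xi> powr r))"
    using \<open>finite B\<close> \<open>1 \<le> r\<close> by (intro mult_left_mono powr_sum_le) (auto simp: T_def)
  also have "real (card B) powr (r - 1) = real M powr (real n * (r - 1))"
    using \<open>M > 0\<close> by (simp add: card powr_realpow[symmetric] powr_powr)
  finally have "A powr r \<le> real M powr (- real n * r / 2 + real n * (r - 1)) * (\<Sum>\<xi>\<in>B. T \<xi> powr r)"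
    by (simp only: powr_add mult.assoc)
  also have "- real n * r / 2 + real n * (r - 1) = - (real n * (1 - r / 2))"
    by (simp add: field_simps)
  finally have "A powr r * real M powr (real n * (1 - r / 2)) \<le> (\<Sum>\<xi>\<in>B. T \<xi> powr r)"
    using \<open>M > 0\<close> by (simp add: powr_minus field_simps)
  also have "\<dots> \<le> (\<Sum>\<xi>\<in>zmod_vec N n. T \<xi> powr r)"
    using \<open>B \<subseteq> zmod_vec N n\<close> by (intro sum_mono2) auto
  finally show ?thesis
    using \<open>q > 0\<close> by (simp add: A_def T_def M)
qed

text \<open>For constant density the slice is itself a product of Gauss sums, of constant modulus on
  \<open>M ^ n\<close> points and zero elsewhere. The value equals the lower bound of
  \<open>slice_sum_powr_le\<close> taken at the zero frequency.\<close>

lemma sum_slice_sum_1_powr: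
  assumes "odd N" and q: "int q = gcd \<tau> (int N)"
  shows "(\<Sum>\<xi>\<in>zmod_vec N n. norm (slice_sum N n (\<lambda>_. 1) \<tau> \<xi>) powr r)
    = (real N ^ n) powr r * real (N div q) powr (real n * (1 - r / 2))"
proof -
  have "N > 0" using \<open>odd N\<close> by (rule odd_pos)
  have "int q dvd int N" by (simp add: q)
  then have "q dvd N" by simp
  then obtain M where M: "N = M * q" by (metis dvd_def mult.commute)
  have "M > 0" "q > 0" using \<open>N > 0\<close> M by auto
  have M_pow: "real (M ^ n) = real M powr real n"
    using \<open>M > 0\<close> by (simp add: powr_realpow)
  \<comment> \<open>The phase of \<open>slice_sum\<close> carries \<open>- \<tau>\<close>; the sign
    does not affect the gcd.\<close>
  have q': "int q = gcd (- \<tau>) (int N)" using q by simp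
  \<comment> \<open>The form \<open>\<xi> j - 0\<close> matches \<open>card_zmod_vec_cong\<close>
    with centre 0.\<close>
  have norm: "norm (slice_sum N n (\<lambda>_. 1) \<tau> \<xi>) =
      (if \<forall>j<n. int q dvd \<xi> j - 0 then sqrt (real N * real q) ^ n else 0)" for \<xi>
    using norm_sum_add_char_quadratic[OF \<open>odd N\<close> q', of n "\<lambda>j. - \<xi> j"]
    by (simp add: slice_sum_def mult.commute sum_negf)
  have "(\<Sum>\<xi>\<in>zmod_vec N n. norm (slice_sum N n (\<lambda>_. 1) \<tau> \<xi>) powr r) =
      (\<Sum>\<xi>\<in>zmod_vec N n. if \<forall>j<n. int q dvd \<xi> j - 0 then (sqrt (real N * real q) ^ n) powr r else 0)"
    unfolding norm by (rule sum.cong) auto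
  also have "\<dots> = real (card {\<xi>\<in>zmod_vec N n. \<forall>j<n. int q dvd \<xi> j - 0}) *
      (sqrt (real N * real q) ^ n) powr r"
    by (simp flip: sum.inter_filter)
  also have "card {\<xi>\<in>zmod_vec N n. \<forall>j<n. int q dvd \<xi> j - 0} = M ^ n"
    using M \<open>N > 0\<close> by (rule card_zmod_vec_cong)
  also have "sqrt (real N * real q) = real N * real M powr (- 1 / 2)"
    using \<open>M > 0\<close> \<open>q > 0\<close>
    by (simp add: M real_sqrt_mult powr_minus powr_half_sqrt field_simps)
  also have "\<dots> ^ n = real N ^ n * real M powr (- real n / 2)"
    using \<open>M > 0\<close> by (simp add: power_mult_distrib powr_realpow[symmetric] powr_powr)
  also have "real (M ^ n) * (real N ^ n * real M powr (- real n / 2)) powr r =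
      (real N ^ n) powr r * real M powr (real n + (- real n / 2) * r)"
    unfolding M_pow powr_add by (simp add: powr_mult powr_powr)
  also have "real n + (- real n / 2) * r = real n * (1 - r / 2)"
    by (simp add: field_simps)
  finally show ?thesis
    using \<open>q > 0\<close> by (simp add: M)
qed

section \<open>The divisor sum as a sum over slices\<close>

text \<open>Residues are grouped by their gcd \<open>q\<close> with \<open>N\<close>: each group has
  \<open>totient (N div q)\<close> members, and \<open>N div q\<close> is their additive
  order.\<close>

lemma sum_residues_gcd:
  fixes h :: "nat \<Rightarrow> real"
  assumes "N > 0"
  shows "(\<Sum>\<tau>\<in>{0..<int N}. h (N div nat (gcd \<tau> (int N)))) = (\<Sum>M | M dvd N. real (totient M) * h M)"
proof -
  have "(\<Sum>\<tau>\<in>{0..<int N}. h (N div nat (gcd \<tau> (int N)))) = (\<Sum>k\<in>{0<..N}. h (N div gcd k N))"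
  proof (rule sum.reindex_bij_witness)
    fix \<tau> assume \<tau>: "\<tau> \<in> {0..<int N}"
    \<comment> \<open>The totient count runs over \<open>{0<..N}\<close>, so the residue 0 is
      represented by \<open>N\<close>, which has the same gcd with \<open>N\<close>.\<close>
    let ?k = "if \<tau> = 0 then N else nat \<tau>"
    show "int ?k mod int N = \<tau>" "?k \<in> {0<..N}"
      using \<tau> \<open>N > 0\<close> by auto
    show "h (N div gcd ?k N) = h (N div nat (gcd \<tau> (int N)))"
    proof -
      obtain m where "\<tau> = int m"
        using \<tau> zero_le_imp_eq_int[of \<tau>] by auto
      then show ?thesis by simp
    qed
  next
    fix k assume k: "k \<in> {0<..N}"
    show "int k mod int N \<in> {0..<int N}"
      using \<open>N > 0\<close> by simp
    show "(if int k mod int N = 0 then N else nat (int k mod int N)) = k"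
      using k by (cases "k = N") auto
  qed
  also have "\<dots> = (\<Sum>q | q dvd N. \<Sum>k\<in>{k\<in>{0<..N}. gcd k N = q}. h (N div gcd k N))"
    using \<open>N > 0\<close> by (intro sum.group[symmetric]) auto
  also have "\<dots> = (\<Sum>q | q dvd N. real (totient (N div q)) * h (N div q))"
    using \<open>N > 0\<close> by (intro sum.cong refl) (simp flip: card_gcd_eq_totient)
  \<comment> \<open>Passing from \<open>q\<close> to the complementary divisor
    \<open>N div q\<close> permutes the divisors of \<open>N\<close>.\<close>
  also have "\<dots> = (\<Sum>M | M dvd N. real (totient M) * h M)"
    using \<open>N > 0\<close>
    by (intro sum.reindex_bij_witness[of _ "(div) N" "(div) N"]) (auto elim: dvdE)
  finally show ?thesis .
qed

lemma divisor_sum_eq_sum_residues: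
  assumes "N > 0"
  shows "divisor_sum N (Suc n) r =
    (\<Sum>\<tau>\<in>{0..<int N}. real (N div nat (gcd \<tau> (int N))) powr (real n * (1 - r / 2)))"
  by (subst sum_residues_gcd[OF assms]) (simp add: divisor_sum_def)

lemma divisor_sum_pos:
  assumes "N > 0"
  shows "divisor_sum N d r > 0"
  unfolding divisor_sum_def
  by (rule sum_pos2[of _ 1]) (use assms in auto)

section \<open>The transform of functions carried by the paraboloid\<close>

lemma zmod_vec_Suc:
  "zmod_vec N (Suc n) = (\<lambda>(\<tau>, \<xi>). \<xi>(n := \<tau>)) ` ({0..<int N} \<times> zmod_vec N n)"
  by (simp add: zmod_vec_def lessThan_Suc PiE_insert_eq)

lemma sum_zmod_vec_Suc:
  "(\<Sum>x\<in>zmod_vec N (Suc n). h x) = (\<Sum>\<tau>\<in>{0..<int N}. \<Sum>\<xi>\<in>zmod_vec N n. h (\<xi>(n := \<tau>)))"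
proof -
  have "inj_on (\<lambda>(\<tau>, \<xi>). \<xi>(n := \<tau>)) ({0..<int N} \<times> zmod_vec N n)"
    unfolding zmod_vec_def by (rule inj_combinator) simp
  then show ?thesis
    by (simp add: zmod_vec_Suc sum.reindex sum.cartesian_product case_prod_unfold)
qed

lemma zmod_vec_nonempty: "N > 0 \<Longrightarrow> zmod_vec N n \<noteq> {}"
  by (simp add: zmod_vec_def PiE_eq_empty_iff)

lemma exp_eq_add_char:
  "exp (- 2 * complex_of_real pi * \<i> * of_int k / of_nat N) = add_char N (- k)"
  by (simp add: add_char_def cis_conv_exp mult_ac)

text \<open>The parametrisation of the paraboloid by \<open>t\<close> is injective, and the
  character does not see the reduction of \<open>|t|^2\<close> modulo \<open>N\<close>.\<close>

lemma fourier_paraboloid: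
  assumes "N > 0" and supp: "supp N (Suc n) f \<subseteq> paraboloid N (Suc n)"
  shows "fourier N (Suc n) f (\<xi>(n := \<tau>)) = of_real (real N powr (- real (Suc n) / 2)) *
    slice_sum N n (\<lambda>t. f (t(n := (\<Sum>j<n. (t j)\<^sup>2) mod int N))) \<tau> \<xi>"
proof -
  define \<phi> where "\<phi> t = t(n := (\<Sum>j<n. (t j)\<^sup>2) mod int N)" for t :: "nat \<Rightarrow> int"
  define E where "E x = exp (- 2 * complex_of_real pi * \<i> *
      of_int (\<Sum>j<Suc n. x j * (\<xi>(n := \<tau>)) j) / of_nat N)" for x
  have P: "paraboloid N (Suc n) = \<phi> ` zmod_vec N n"
    by (auto simp: paraboloid_def \<phi>_def)
  have inj: "inj_on \<phi> (zmod_vec N n)"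
  proof (rule inj_onI, rule ext)
    fix s t j assume st: "s \<in> zmod_vec N n" "t \<in> zmod_vec N n" "\<phi> s = \<phi> t"
    show "s j = t j"
    proof (cases "j < n")
      case True
      then show ?thesis using fun_cong[OF st(3), of j] by (simp add: \<phi>_def)
    next
      \<comment> \<open>From index \<open>n\<close> on, \<open>\<phi>\<close> may have overwritten a
        value, but \<open>s\<close> and \<open>t\<close> both take the default value
        \<open>undefined\<close> there.\<close>
      case False
      then show ?thesis
        using st(1,2) unfolding zmod_vec_def by (metis PiE_arb lessThan_iff)
    qed
  qed
  have E: "E (\<phi> t) = add_char N (- (\<tau> * (\<Sum>j<n. (t j)\<^sup>2) + (\<Sum>j<n. t j * \<xi> j)))" for t
  proof -
    have "E (\<phi> t) = add_char N (- (\<Sum>j<Suc n. \<phi> t j * (\<xi>(n := \<tau>)) j))"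
      by (simp only: E_def exp_eq_add_char)
    also have "(\<Sum>j<Suc n. \<phi> t j * (\<xi>(n := \<tau>)) j) =
        (\<Sum>j<n. t j * \<xi> j) + (\<Sum>j<n. (t j)\<^sup>2) mod int N * \<tau>"
      by (simp add: \<phi>_def)
    also have "add_char N (- \<dots>) = add_char N (- ((\<Sum>j<n. t j * \<xi> j) + (\<Sum>j<n. (t j)\<^sup>2) * \<tau>))"
      by (rule add_char_cong, intro cong_minus_minus_iff[THEN iffD2] cong_add cong_mult cong_refl)
        (simp add: cong_def)
    finally show ?thesis by (simp only: add.commute mult.commute)
  qed
  have "(\<Sum>x\<in>zmod_vec N (Suc n). f x * E x) = (\<Sum>x\<in>paraboloid N (Suc n). f x * E x)"
    using supp paraboloid_subset[of "Suc n" N] \<open>N > 0\<close>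
    by (intro sum.mono_neutral_right) (auto simp: supp_def)
  also have "\<dots> = (\<Sum>t\<in>zmod_vec N n. f (\<phi> t) * E (\<phi> t))"
    using inj by (simp add: P sum.reindex)
  finally show ?thesis
    by (simp only: fourier_def slice_sum_def E E_def[symmetric] \<phi>_def[symmetric])
qed

text \<open>The slice bound is summed over all \<open>\<tau>\<close>: modulo \<open>N\<close>,
  \<open>\<tau> - \<tau>\<^sub>0\<close> runs through the residues together with
  \<open>\<tau>\<close>, so the weights add up to the divisor sum whatever the frequency
  \<open>x\<close>.\<close>

lemma norm_fourier_powr_le:
  assumes "odd N" "1 \<le> r" and supp: "supp N (Suc n) f \<subseteq> paraboloid N (Suc n)"
    and x: "x \<in> zmod_vec N (Suc n)"
  shows "norm (fourier N (Suc n) f x) powr r * divisor_sum N (Suc n) r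
    \<le> (\<Sum>y\<in>zmod_vec N (Suc n). norm (fourier N (Suc n) f y) powr r)"
proof -
  have "N > 0" using \<open>odd N\<close> by (rule odd_pos)
  obtain \<xi>\<^sub>0 \<tau>\<^sub>0 where x: "x = \<xi>\<^sub>0(n := \<tau>\<^sub>0)"
    using x by (auto simp: zmod_vec_Suc)
  define c where "c = real N powr (- real (Suc n) / 2)"
  have "c \<ge> 0" by (simp add: c_def)
  define g where "g t = f (t(n := (\<Sum>j<n. (t j)\<^sup>2) mod int N))" for t
  define w where "w \<tau> = real (N div nat (gcd \<tau> (int N))) powr (real n * (1 - r / 2))" for \<tau>
  have F: "norm (fourier N (Suc n) f (\<xi>(n := \<tau>))) = c * norm (slice_sum N n g \<tau> \<xi>)" for \<xi> \<tau>
    using \<open>c \<ge> 0\<close>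
    by (simp only: fourier_paraboloid[OF \<open>N > 0\<close> supp] norm_mult c_def[symmetric] g_def[symmetric])
      simp
  have "divisor_sum N (Suc n) r = (\<Sum>\<tau>\<in>{0..<int N}. w \<tau>)"
    unfolding w_def by (rule divisor_sum_eq_sum_residues[OF \<open>N > 0\<close>])
  \<comment> \<open>\<open>w\<close> depends only on the gcd with \<open>N\<close>, hence is
    periodic.\<close>
  also have "\<dots> = (\<Sum>\<tau>\<in>{0..<int N}. w (\<tau> + - \<tau>\<^sub>0))"
    by (rule sum_residues_shift[symmetric]) (simp add: w_def gcd.commute gcd_red_int[symmetric])
  finally have "norm (fourier N (Suc n) f x) powr r * divisor_sum N (Suc n) r =
      (\<Sum>\<tau>\<in>{0..<int N}. c powr r * (norm (slice_sum N n g \<tau>\<^sub>0 \<xi>\<^sub>0) powr r * w (\<tau> - \<tau>\<^sub>0)))"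
    using \<open>c \<ge> 0\<close> by (simp add: x F powr_mult sum_distrib_left mult.assoc)
  also have "\<dots> \<le> (\<Sum>\<tau>\<in>{0..<int N}. c powr r *
      (\<Sum>\<xi>\<in>zmod_vec N n. norm (slice_sum N n g \<tau> \<xi>) powr r))"
    unfolding w_def
    by (intro sum_mono mult_left_mono slice_sum_powr_le[OF \<open>odd N\<close> \<open>1 \<le> r\<close>]) auto
  also have "\<dots> = (\<Sum>y\<in>zmod_vec N (Suc n). norm (fourier N (Suc n) f y) powr r)"
    using \<open>c \<ge> 0\<close> by (simp add: sum_zmod_vec_Suc F powr_mult sum_distrib_left)
  finally show ?thesis .
qed

text \<open>Taking \<open>r\<close>-th roots in \<open>norm_fourier_powr_le\<close> at every
  frequency gives the upper half of the formula for the constant.\<close>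

lemma norm_max_fourier_le:
  assumes "odd N" "1 \<le> r" and supp: "supp N (Suc n) f \<subseteq> paraboloid N (Suc n)"
  shows "norm_max N (Suc n) (fourier N (Suc n) f)
    \<le> divisor_sum N (Suc n) r powr (- 1 / r) * norm_r N (Suc n) r (fourier N (Suc n) f)"
proof -
  have "N > 0" using \<open>odd N\<close> by (rule odd_pos)
  let ?D = "divisor_sum N (Suc n) r"
  let ?F = "fourier N (Suc n) f"
  have D: "?D > 0" using \<open>N > 0\<close> by (rule divisor_sum_pos)
  have "norm (?F x) \<le> ?D powr (- 1 / r) * norm_r N (Suc n) r ?F" if "x \<in> zmod_vec N (Suc n)" for x
  proof -
    have "norm (?F x) = (norm (?F x) powr r) powr (1 / r)"
      using \<open>1 \<le> r\<close> by (simp add: powr_powr)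
    also have "\<dots> \<le> ((\<Sum>y\<in>zmod_vec N (Suc n). norm (?F y) powr r) / ?D) powr (1 / r)"
      using norm_fourier_powr_le[OF assms that] D \<open>1 \<le> r\<close>
      by (intro powr_mono2) (auto simp: field_simps)
    also have "\<dots> = ?D powr (- 1 / r) * norm_r N (Suc n) r ?F"
      using D by (simp add: norm_r_def powr_divide powr_minus sum_nonneg field_simps)
    finally show ?thesis .
  qed
  then show ?thesis
    unfolding norm_max_def using zmod_vec_nonempty[OF \<open>N > 0\<close>, of "Suc n"]
    by (subst Max_le_iff) auto
qed

section \<open>The extremal function\<close>

lemma norm_max_fourier_ge:
  "x \<in> zmod_vec N d \<Longrightarrow> norm (fourier N d f x) \<le> norm_max N d (fourier N d f)"
  unfolding norm_max_def by (intro Max_ge) auto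

text \<open>At frequency zero the transform is the constant value of \<open>f\<close> times
  \<open>N powr (- (n + 1) / 2) * N ^ n\<close>; the constant is chosen to make this
  \<open>D powr (- 1 / r)\<close> for the divisor sum \<open>D\<close>. By
  \<open>sum_slice_sum_1_powr\<close> the \<open>r\<close>-norm is then 1, and the upper bound shows
  that no frequency gives more.\<close>

lemma extremal_fourier:
  fixes n :: nat
  assumes "odd N" "1 \<le> r"
  defines "f \<equiv> \<lambda>x. if x \<in> paraboloid N (Suc n)
      then complex_of_real (real N powr (real (Suc n) / 2 - real n) * divisor_sum N (Suc n) r powr (- 1 / r))
      else 0"
  shows "supp N (Suc n) f = paraboloid N (Suc n)"
    and "norm_r N (Suc n) r (fourier N (Suc n) f) = 1"
    and "norm_max N (Suc n) (fourier N (Suc n) f) = divisor_sum N (Suc n) r powr (- 1 / r)"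
proof -
  have "N > 0" using \<open>odd N\<close> by (rule odd_pos)
  define D where "D = divisor_sum N (Suc n) r"
  have D: "D > 0" unfolding D_def using \<open>N > 0\<close> by (rule divisor_sum_pos)
  define c where "c = real N powr (real (Suc n) / 2 - real n) * D powr (- 1 / r)"
  have f: "f x = (if x \<in> paraboloid N (Suc n) then of_real c else 0)" for x
    by (simp add: f_def c_def D_def)
  have "c > 0" using \<open>N > 0\<close> D by (simp add: c_def)
  show supp: "supp N (Suc n) f = paraboloid N (Suc n)"
    using paraboloid_subset[of "Suc n" N] \<open>N > 0\<close> \<open>c > 0\<close> by (auto simp: supp_def f)
  \<comment> \<open>The unitary factor times the constant \<open>c\<close>; the powers of
    \<open>N\<close> collapse to \<open>1 / N ^ n\<close>.\<close>
  define b where "b = D powr (- 1 / r) / real N ^ n"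
  have "b \<ge> 0" by (simp add: b_def)
  have F: "norm (fourier N (Suc n) f (\<xi>(n := \<tau>))) = b * norm (slice_sum N n (\<lambda>_. 1) \<tau> \<xi>)" for \<xi> \<tau>
  proof -
    have "slice_sum N n (\<lambda>t. f (t(n := (\<Sum>j<n. (t j)\<^sup>2) mod int N))) \<tau> \<xi> =
        of_real c * slice_sum N n (\<lambda>_. 1) \<tau> \<xi>"
      unfolding slice_sum_def sum_distrib_left
      by (intro sum.cong refl) (auto simp: f paraboloid_def)
    then have "norm (fourier N (Suc n) f (\<xi>(n := \<tau>))) =
        (real N powr (- real (Suc n) / 2) * c) * norm (slice_sum N n (\<lambda>_. 1) \<tau> \<xi>)"
      using supp \<open>N > 0\<close> \<open>c > 0\<close> by (simp add: fourier_paraboloid norm_mult)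
    also have "real N powr (- real (Suc n) / 2) * c =
        real N powr (- real (Suc n) / 2 + (real (Suc n) / 2 - real n)) * D powr (- 1 / r)"
      by (simp only: c_def powr_add mult.assoc)
    also have "\<dots> = b"
      using \<open>N > 0\<close> by (simp add: b_def powr_minus powr_realpow field_simps)
    finally show ?thesis .
  qed
  have slice: "(\<Sum>\<xi>\<in>zmod_vec N n. norm (slice_sum N n (\<lambda>_. 1) \<tau> \<xi>) powr r) = (real N ^ n) powr r *
      real (N div nat (gcd \<tau> (int N))) powr (real n * (1 - r / 2))" for \<tau>
    by (rule sum_slice_sum_1_powr[OF \<open>odd N\<close>]) simp
  have "(\<Sum>y\<in>zmod_vec N (Suc n). norm (fourier N (Suc n) f y) powr r) =
      b powr r * ((real N ^ n) powr r * D)"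
    using \<open>b \<ge> 0\<close> \<open>N > 0\<close>
    by (simp add: sum_zmod_vec_Suc F powr_mult slice
        divisor_sum_eq_sum_residues D_def flip: sum_distrib_left)
  also have "\<dots> = (b * real N ^ n) powr r * D"
    using \<open>b \<ge> 0\<close> by (simp add: powr_mult)
  also have "\<dots> = 1"
  proof -
    have "b * real N ^ n = D powr (- 1 / r)" using \<open>N > 0\<close> by (simp add: b_def)
    then have "(b * real N ^ n) powr r = D powr - 1"
      using \<open>1 \<le> r\<close> by (simp only: powr_powr) simp
    then show ?thesis using D by (simp add: powr_minus)
  qed
  finally show r: "norm_r N (Suc n) r (fourier N (Suc n) f) = 1"
    by (simp add: norm_r_def)
  have card: "card (zmod_vec N n) = N ^ n"
    by (simp add: zmod_vec_def card_PiE)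
  \<comment> \<open>At the zero frequency all characters equal 1, so the slice sum is the number
    \<open>N ^ n\<close> of parameters.\<close>
  obtain \<xi> where \<xi>: "\<xi> \<in> zmod_vec N n" "\<And>j. j < n \<Longrightarrow> \<xi> j = 0"
    using \<open>N > 0\<close> by (intro that[of "\<lambda>j\<in>{..<n}. 0"]) (auto simp: zmod_vec_def)
  have "norm (fourier N (Suc n) f (\<xi>(n := 0))) = D powr (- 1 / r)"
    using \<open>N > 0\<close> by (simp add: F slice_sum_def \<xi> card b_def norm_power)
  moreover have "\<xi>(n := 0) \<in> zmod_vec N (Suc n)"
    using \<xi> \<open>N > 0\<close> by (auto simp: zmod_vec_Suc image_iff intro!: bexI[of _ "(0, \<xi>)"])
  ultimately have "D powr (- 1 / r) \<le> norm_max N (Suc n) (fourier N (Suc n) f)"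
    using norm_max_fourier_ge by metis
  moreover have "norm_max N (Suc n) (fourier N (Suc n) f) \<le> D powr (- 1 / r)"
    using norm_max_fourier_le[OF \<open>odd N\<close> \<open>1 \<le> r\<close>, of n f] supp r by (simp add: D_def)
  ultimately show "norm_max N (Suc n) (fourier N (Suc n) f) = divisor_sum N (Suc n) r powr (- 1 / r)"
    by (simp add: D_def)
qed

section \<open>The synthesis constant and the criterion for uniform synthesis\<close>

lemma norm_max_nonneg:
  assumes "N > 0"
  shows "norm_max N d h \<ge> 0"
proof -
  obtain x where "x \<in> zmod_vec N d" using zmod_vec_nonempty[OF assms] by blast
  then have "norm (h x) \<le> norm_max N d h" unfolding norm_max_def by (intro Max_ge) auto
  then show ?thesis using norm_ge_zero order_trans by blast
qed

text \<open>The supremum is a maximum: \<open>norm_max_fourier_le\<close> bounds every quotient and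
  \<open>extremal_fourier\<close> attains the bound.\<close>

theorem synthesis_const_paraboloid:
  assumes "odd N" "1 \<le> r"
  shows "synthesis_const N (Suc n) r (paraboloid N (Suc n)) = divisor_sum N (Suc n) r powr (- 1 / r)"
  unfolding synthesis_const_def
proof (rule cSup_eq_maximum)
  have "N > 0" using \<open>odd N\<close> by (rule odd_pos)
  then have "paraboloid N (Suc n) \<noteq> {}" by (intro paraboloid_nonempty) simp
  then show "divisor_sum N (Suc n) r powr (- 1 / r) \<in>
      (\<lambda>f. norm_max N (Suc n) (fourier N (Suc n) f) / norm_r N (Suc n) r (fourier N (Suc n) f)) `
      {f. supp N (Suc n) f \<noteq> {} \<and> supp N (Suc n) f \<subseteq> paraboloid N (Suc n)}"
    by (intro image_eqI[OF _ CollectI]) (use extremal_fourier[OF assms, of n] in auto)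
  fix y assume "y \<in> (\<lambda>f. norm_max N (Suc n) (fourier N (Suc n) f) / norm_r N (Suc n) r (fourier N (Suc n) f)) `
      {f. supp N (Suc n) f \<noteq> {} \<and> supp N (Suc n) f \<subseteq> paraboloid N (Suc n)}"
  then obtain f where f: "supp N (Suc n) f \<subseteq> paraboloid N (Suc n)"
    and y: "y = norm_max N (Suc n) (fourier N (Suc n) f) / norm_r N (Suc n) r (fourier N (Suc n) f)"
    by blast
  have "norm_r N (Suc n) r (fourier N (Suc n) f) \<ge> 0" by (simp add: norm_r_def)
  \<comment> \<open>A quotient with vanishing denominator is 0 because division by zero yields 0, so
    it lies below the bound as well.\<close>
  then show "y \<le> divisor_sum N (Suc n) r powr (- 1 / r)"
    using norm_max_fourier_le[OF assms f]
    by (cases "norm_r N (Suc n) r (fourier N (Suc n) f) = 0") (auto simp: y field_simps)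
qed

text \<open>Necessity is tested on the extremal functions, normalised to \<open>r\<close>-norm 1;
  sufficiency squeezes \<open>norm_max\<close> between 0 and the bound of
  \<open>norm_max_fourier_le\<close>.\<close>

theorem uniform_spectral_synthesis_paraboloid_iff:
  assumes "1 \<le> r" and odd: "\<And>N. N \<in> \<N> \<Longrightarrow> odd N"
  shows "uniform_spectral_synthesis \<N> (Suc n) (\<lambda>N. paraboloid N (Suc n)) r \<longleftrightarrow>
    filterlim (\<lambda>N. divisor_sum N (Suc n) r) at_top (moduli_at_top \<N>)"
proof
  have ev: "eventually (\<lambda>N. N \<in> \<N>) (moduli_at_top \<N>)"
    by (simp add: moduli_at_top_def eventually_inf_principal)
  have pos: "N > 0" if "N \<in> \<N>" for N
    using odd[OF that] by (rule odd_pos)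
  let ?D = "\<lambda>N. divisor_sum N (Suc n) r"
  have D_pos: "?D N > 0" if "N \<in> \<N>" for N
    using pos[OF that] by (rule divisor_sum_pos)
  let ?F = "\<lambda>f N. fourier N (Suc n) (f N)"
  {
    assume syn: "uniform_spectral_synthesis \<N> (Suc n) (\<lambda>N. paraboloid N (Suc n)) r"
    define f where "f N x = (if x \<in> paraboloid N (Suc n)
      then complex_of_real (real N powr (real (Suc n) / 2 - real n) * ?D N powr (- 1 / r))
      else 0)" for N x
    note f = extremal_fourier[OF odd \<open>1 \<le> r\<close>, of _ n, folded f_def]
    have "((\<lambda>N. norm_max N (Suc n) (?F f N)) \<longlongrightarrow> 0) (moduli_at_top \<N>)"
      using syn unfolding uniform_spectral_synthesis_def
      by (elim allE[of _ f] impE) (auto simp: f)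
    then have "((\<lambda>N. ?D N powr (- 1 / r)) \<longlongrightarrow> 0) (moduli_at_top \<N>)"
      by (rule Lim_transform_eventually) (use ev in \<open>auto simp: f elim: eventually_mono\<close>)
    \<comment> \<open>Positivity of the divisor sum makes the convergence one-sided, so the power
      \<open>- r\<close> sends it to infinity; that power also undoes the exponent
      \<open>- 1 / r\<close>.\<close>
    then have "filterlim (\<lambda>N. ?D N powr (- 1 / r)) (at_right 0) (moduli_at_top \<N>)"
      using ev by (auto simp: filterlim_at elim!: eventually_mono dest: D_pos)
    then have "filterlim (\<lambda>N. (?D N powr (- 1 / r)) powr (- r)) at_top (moduli_at_top \<N>)"
      by (rule filterlim_compose[rotated]) (use \<open>1 \<le> r\<close> in real_asymp)
    then show "filterlim ?D at_top (moduli_at_top \<N>)"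
      by (rule filterlim_mono_eventually)
        (use ev \<open>1 \<le> r\<close> in \<open>auto elim!: eventually_mono dest: D_pos simp: powr_powr\<close>)
  next
    assume lim: "filterlim ?D at_top (moduli_at_top \<N>)"
    show "uniform_spectral_synthesis \<N> (Suc n) (\<lambda>N. paraboloid N (Suc n)) r"
      unfolding uniform_spectral_synthesis_def
    proof (intro allI impI)
      fix f :: "nat \<Rightarrow> (nat \<Rightarrow> int) \<Rightarrow> complex"
      assume supp: "\<forall>N\<in>\<N>. supp N (Suc n) (f N) \<subseteq> paraboloid N (Suc n)"
        and bdd: "bdd_above ((\<lambda>N. norm_r N (Suc n) r (?F f N)) ` \<N>)"
      then obtain C where C: "norm_r N (Suc n) r (?F f N) \<le> C" if "N \<in> \<N>" for N
        by (auto simp: bdd_above_def)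
      have "((\<lambda>D. D powr (- 1 / r)) \<longlongrightarrow> 0) at_top"
        using \<open>1 \<le> r\<close> by real_asymp
      from filterlim_compose[OF this lim]
      have lim0: "((\<lambda>N. ?D N powr (- 1 / r) * C) \<longlongrightarrow> 0) (moduli_at_top \<N>)"
        by (rule tendsto_mult_left_zero)
      show "((\<lambda>N. norm_max N (Suc n) (?F f N)) \<longlongrightarrow> 0) (moduli_at_top \<N>)"
      proof (rule tendsto_sandwich[OF _ _ tendsto_const lim0])
        show "eventually (\<lambda>N. 0 \<le> norm_max N (Suc n) (?F f N)) (moduli_at_top \<N>)"
          using ev by eventually_elim (simp add: norm_max_nonneg pos)
        show "eventually (\<lambda>N. norm_max N (Suc n) (?F f N) \<le> ?D N powr (- 1 / r) * C) (moduli_at_top \<N>)"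
          using ev
        proof eventually_elim
          case (elim N)
          have "norm_max N (Suc n) (?F f N) \<le> ?D N powr (- 1 / r) * norm_r N (Suc n) r (?F f N)"
            using supp elim by (intro norm_max_fourier_le \<open>1 \<le> r\<close> odd) auto
          also have "\<dots> \<le> ?D N powr (- 1 / r) * C"
            using C[OF elim] by (intro mult_left_mono) auto
          finally show ?case .
        qed
      qed
    qed
  }
qed

theorem theorem6p2:
  fixes d :: nat and r :: real
  assumes "d \<ge> 2" and "1 \<le> r"
  shows "(\<forall>N::nat. N \<ge> 2 \<and> odd N \<longrightarrow>
            synthesis_const N d r (paraboloid N d) = divisor_sum N d r powr (- 1 / r)) \<and>
         (\<forall>\<N>::nat set. infinite \<N> \<and> (\<forall>N\<in>\<N>. N \<ge> 2 \<and> odd N) \<longrightarrow>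
            (uniform_spectral_synthesis \<N> d (\<lambda>N. paraboloid N d) r \<longleftrightarrow>
             filterlim (\<lambda>N. divisor_sum N d r) at_top (moduli_at_top \<N>)))"
proof -
  \<comment> \<open>The two preceding results are stated for \<open>Suc n\<close>, so that the
    truncated \<open>d - 1\<close> becomes \<open>n\<close>.\<close>
  obtain n where "d = Suc n" using \<open>d \<ge> 2\<close> by (cases d) auto
  then show ?thesis
    using synthesis_const_paraboloid[OF _ \<open>1 \<le> r\<close>, of _ n]
      uniform_spectral_synthesis_paraboloid_iff[OF \<open>1 \<le> r\<close>, of _ n]
    by auto
qed

end
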